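(* Let $E=\{x_1,\dots,x_n\}\subset SG$ be a finite set of ($n$ distinct) points. Then the $n\times n$ matrix with entries $$[G]_{i,j}=\int_{SG}G(x_i,y)G(x_j,y)\,d\mu(y)$$ is invertible. Thus, for given $a_1,\dots,a_n\in\mathbb{R}$, one can find constants $c_1,\dots,c_n$ such that $u(x)=\sum_{i=1}^nc_i\int_{SG}G(x,y)G(x_i,y)\,d\mu(y)$ satisfies the constraints $u(x_i)=a_i$ for all $i$ (together with the Dirichlet boundary conditions $u|_{V_0}=0$).
   Context: Let $q_0,q_1,q_2$ be the vertices of an equilateral triangle in the plane, $F_i(x)=\frac12(x+q_i)$, and let $SG$ (the Sierpinski gasket) be the unique nonempty compact set with $SG=\bigcup_{i}F_i(SG)$. For a word $w$ of length $|w|=m$ let $F_w=F_{w_1}\circ\cdots\circ F_{w_m}$. Put $V_0=\{q_0,q_1,q_2\}$, $V_m=\bigcup_iF_iV_{m-1}$; $x\sim_m y$ means $x\ne y$ and $x,y\in F_wV_0$ for some word $w$ of length $m$. The energy of a continuous $u:SG\to\mathbb{R}$ is $\mathcal{E}(u)=\lim_{m\to\infty}\left(\frac53\right)^m\sum_{\{x,y\}:x\sim_m y}(u(x)-u(y))^2$, $\operatorname{dom}\mathcal{E}$ is the set of continuous $u$ with $\mathcal{E}(u)<\infty$, $\mathcal{E}(u,v)$ is the associated bilinear form, and $\operatorname{dom}\mathcal{E}_0=\{u\in\operatorname{dom}\mathcal{E}:u|_{V_0}=0\}$. $\mu$ is the self-similar probability measure with $\mu(F_wSG)=3^{-|w|}$.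 $G$ is the Dirichlet Green's function: for each $y\in SG$, $G(\cdot,y)$ is the unique element of $\operatorname{dom}\mathcal{E}_0$ with $\mathcal{E}(G(\cdot,y),v)=v(y)$ for all $v\in\operatorname{dom}\mathcal{E}_0$; $G$ is symmetric and continuous.
   Formalization: The points x_i are additionally assumed not to lie in V_0; if some x_i is in V_0 then G(x_i,·)=0, so the matrix has a zero row and is singular, and u(x_i)=a_i≠0 contradicts u|_{V_0}=0. *)

theory Defs
  imports "HOL-Analysis.Analysis" "HOL-Probability.Probability"
begin

text \<open>
  The vertices \<open>q\<^sub>0, q\<^sub>1, q\<^sub>2\<close> are a function on the three-element type \<^typ>\<open>3\<close>, so that words are
  simply lists of type \<^typ>\<open>3 list\<close>. Functions on the gasket are total functions on the plane of
  which only the values on the gasket matter.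
\<close>

definition equilateral :: "(3 \<Rightarrow> real^2) \<Rightarrow> bool" where
  "equilateral q \<longleftrightarrow> (\<exists>s>0. \<forall>i j. i \<noteq> j \<longrightarrow> dist (q i) (q j) = s)"

definition sg_map :: "(3 \<Rightarrow> real^2) \<Rightarrow> 3 \<Rightarrow> real^2 \<Rightarrow> real^2" where
  "sg_map q i x = (1/2) *\<^sub>R (x + q i)"

definition SG :: "(3 \<Rightarrow> real^2) \<Rightarrow> (real^2) set" where
  "SG q = (THE K. compact K \<and> K \<noteq> {} \<and> K = (\<Union>i. sg_map q i ` K))"

primrec sg_word :: "(3 \<Rightarrow> real^2) \<Rightarrow> 3 list \<Rightarrow> real^2 \<Rightarrow> real^2" where
  "sg_word q [] = id"
| "sg_word q (i # w) = sg_map q i \<circ> sg_word q w"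

definition V0 :: "(3 \<Rightarrow> real^2) \<Rightarrow> (real^2) set" where
  "V0 q = range q"

definition sg_adj :: "(3 \<Rightarrow> real^2) \<Rightarrow> nat \<Rightarrow> real^2 \<Rightarrow> real^2 \<Rightarrow> bool" where
  "sg_adj q m x y \<longleftrightarrow>
     x \<noteq> y \<and> (\<exists>w. length w = m \<and> x \<in> sg_word q w ` V0 q \<and> y \<in> sg_word q w ` V0 q)"

text \<open>
  The energy sums over unordered edges \<open>{x, y}\<close>; below the sum runs over ordered pairs, in which
  every edge occurs exactly twice, whence the factor \<open>1/2\<close>.
\<close>

definition graph_energy :: "(3 \<Rightarrow> real^2) \<Rightarrow> nat \<Rightarrow> (real^2 \<Rightarrow> real) \<Rightarrow> real" where
  "graph_energy q m u =
     (5/3)^m * ((1/2) * (\<Sum>(x, y) \<in> {(x, y). sg_adj q m x y}. (u x - u y)\<^sup>2))"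

text \<open>
  The graph energies increase with \<open>m\<close>, so the limit always exists in the extended reals.
\<close>

definition energy :: "(3 \<Rightarrow> real^2) \<Rightarrow> (real^2 \<Rightarrow> real) \<Rightarrow> ereal" where
  "energy q u = lim (\<lambda>m. ereal (graph_energy q m u))"

definition dom_energy :: "(3 \<Rightarrow> real^2) \<Rightarrow> (real^2 \<Rightarrow> real) set" where
  "dom_energy q = {u. continuous_on (SG q) u \<and> energy q u < \<infinity>}"

text \<open>The bilinear form associated with the quadratic form \<^const>\<open>energy\<close>, by polarization.\<close>

definition energy_form :: "(3 \<Rightarrow> real^2) \<Rightarrow> (real^2 \<Rightarrow> real) \<Rightarrow> (real^2 \<Rightarrow> real) \<Rightarrow> real" where
  "energy_form q u v =
     (real_of_ereal (energy q (\<lambda>x. u x + v x)) - real_of_ereal (energy q (\<lambda>x. u x - v x))) / 4"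

definition dom_energy0 :: "(3 \<Rightarrow> real^2) \<Rightarrow> (real^2 \<Rightarrow> real) set" where
  "dom_energy0 q = {u \<in> dom_energy q. \<forall>p\<in>V0 q. u p = 0}"

text \<open>
  The self-similar measure is viewed as a Borel measure on the plane; the empty word shows that it
  is concentrated on the gasket.
\<close>

definition sg_measure :: "(3 \<Rightarrow> real^2) \<Rightarrow> (real^2) measure \<Rightarrow> bool" where
  "sg_measure q \<mu> \<longleftrightarrow>
     prob_space \<mu> \<and> sets \<mu> = sets borel \<and>
     (\<forall>A\<in>sets borel. measure \<mu> A = (\<Sum>i\<in>UNIV. (1/3) * measure \<mu> (sg_map q i -` A))) \<and>
     (\<forall>w. measure \<mu> (sg_word q w ` SG q) = (1/3) ^ length w)"

text \<open>
  This property determines \<open>G\<close> on the square of the gasket.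
\<close>

definition dirichlet_green :: "(3 \<Rightarrow> real^2) \<Rightarrow> (real^2 \<Rightarrow> real^2 \<Rightarrow> real) \<Rightarrow> bool" where
  "dirichlet_green q G \<longleftrightarrow>
     (\<forall>y\<in>SG q. (\<lambda>x. G x y) \<in> dom_energy0 q \<and>
        (\<forall>v\<in>dom_energy0 q. energy_form q (\<lambda>x. G x y) v = v y))"

end

theory Submission
  imports Defs "HOL-Real_Asymp.Real_Asymp"
begin

text \<open>
  The matrix is the Gram matrix in \<open>L\<^sup>2(\<mu>)\<close> of the functions \<open>G(x\<^sub>i, \<cdot>)\<close>. If a combination
  \<open>h = \<Sum> c\<^sub>i G(x\<^sub>i, \<cdot>)\<close> has \<open>L\<^sup>2\<close> norm zero, then \<open>h = 0\<close> on the gasket, because \<open>h\<close> is continuous and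
  every cell has positive measure. The reproducing property turns this into \<open>\<Sum> c\<^sub>i v(x\<^sub>i) = 0\<close> for all
  \<open>v\<close> in the domain of the energy that vanish at the vertices. A spline that is harmonic on the small
  cells, equal to \<open>1\<close> on the cells around \<open>x\<^sub>k\<close> and to \<open>0\<close> on the cells around the other points and the
  vertices, then gives \<open>c\<^sub>k = 0\<close>.
\<close>

section \<open>The gasket as a self-similar set\<close>

locale gasket =
  fixes q :: "3 \<Rightarrow> real^2" and s :: real
  assumes side_pos: "s > 0"
    and side: "\<And>i j. i \<noteq> j \<Longrightarrow> dist (q i) (q j) = s"
begin

text \<open>
  The barycentric coordinates of an equilateral triangle, written through squared distances:
  the quadratic terms in \<open>x\<close> cancel, so this is affine, and the values at the vertices are immediate.
\<close>
definition bary :: "3 \<Rightarrow> real^2 \<Rightarrow> real" where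
  "bary k x = 1/3 + ((\<Sum>j\<in>UNIV. (dist x (q j))\<^sup>2) - 3 * (dist x (q k))\<^sup>2) / (3 * s\<^sup>2)"

text \<open>Reconstruction from the coordinates is built in, so points of the triangle are
  determined by their coordinates; boundedness and \<open>bary_eq_1\<close> rest on this.\<close>

definition triangle :: "(real^2) set" where
  "triangle = {x. (\<forall>k. 0 \<le> bary k x) \<and> x = (\<Sum>k\<in>UNIV. bary k x *\<^sub>R q k)}"

abbreviation hutch :: "(real^2) set \<Rightarrow> (real^2) set" where
  "hutch A \<equiv> (\<Union>i. sg_map q i ` A)"

lemma bary_vertex: "bary k (q j) = (if k = j then 1 else 0)"
proof -
  have d: "(dist (q i) (q l))\<^sup>2 = (if i = l then 0 else s\<^sup>2)" for i l
    using side[of i l] by auto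
  have "s \<noteq> 0" using side_pos by simp
  have "(\<Sum>l\<in>UNIV. (dist (q j) (q l))\<^sup>2) = 2 * s\<^sup>2"
    unfolding d using exhaust_3[of j] by (auto simp: sum_3)
  then show ?thesis
    unfolding bary_def d using \<open>s \<noteq> 0\<close> by (auto simp: field_simps)
qed

lemma bary_sum: "(\<Sum>k\<in>UNIV. bary k x) = 1"
  using side_pos by (simp add: bary_def sum_3 field_simps)

lemma bary_map: "bary k (sg_map q i x) = (bary k x + (if k = i then 1 else 0)) / 2"
proof -
  \<comment> \<open>Length of a median. The correction term does not depend on \<open>p\<close>, so
    it drops out of \<open>bary\<close>, where three squared distances are balanced against three
    copies of one.\<close>
  have mid: "(dist (sg_map q i x) p)\<^sup>2 = ((dist x p)\<^sup>2 + (dist (q i) p)\<^sup>2) / 2 - (dist x (q i))\<^sup>2 / 4" for p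
    unfolding sg_map_def dist_norm power2_norm_eq_inner
    by (simp add: algebra_simps inner_commute add_divide_distrib diff_divide_distrib)
  have "bary k (sg_map q i x) = (bary k x + bary k (q i)) / 2"
    using side_pos unfolding bary_def mid by (simp add: sum_3 field_simps)
  then show ?thesis by (simp add: bary_vertex)
qed

lemma inj_vertices: "q i = q j \<longleftrightarrow> i = j"
  using side[of i j] side_pos by (cases "i = j") auto

lemma continuous_bary [continuous_intros]: "continuous_on A (bary k)"
  unfolding bary_def by (intro continuous_intros) (use side_pos in auto)

lemma triangle_map:
  assumes "x \<in> triangle" shows "sg_map q i x \<in> triangle"
proof -
  have x: "x = (\<Sum>k\<in>UNIV. bary k x *\<^sub>R q k)" and nn: "\<And>k. 0 \<le> bary k x"
    using assms by (auto simp: triangle_def)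
  have "(\<Sum>k\<in>UNIV. bary k (sg_map q i x) *\<^sub>R q k) 
      = (1/2) *\<^sub>R ((\<Sum>k\<in>UNIV. bary k x *\<^sub>R q k) + q i)"
    unfolding bary_map using exhaust_3[of i] by (auto simp: sum_3 algebra_simps add_divide_distrib)
  also have "\<dots> = sg_map q i x" using x by (simp add: sg_map_def)
  finally show ?thesis using nn by (auto simp: triangle_def bary_map)
qed

lemma bary_le_1: "x \<in> triangle \<Longrightarrow> bary k x \<le> 1"
  using bary_sum[of x] member_le_sum[of k UNIV "\<lambda>k. bary k x"] by (auto simp: triangle_def)

lemma compact_triangle: "compact triangle"
proof -
  have "closed triangle" unfolding triangle_def
    by (intro closed_Collect_conj closed_Collect_all closed_Collect_le closed_Collect_eq continuous_intros)
  moreover have "norm x \<le> (\<Sum>k\<in>UNIV. norm (q k))" if "x \<in> triangle" for x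
  proof -
    have "norm x = norm (\<Sum>k\<in>UNIV. bary k x *\<^sub>R q k)"
      using that by (simp add: triangle_def)
    also have "\<dots> \<le> (\<Sum>k\<in>UNIV. norm (bary k x *\<^sub>R q k))" by (rule norm_sum)
    also have "\<dots> \<le> (\<Sum>k\<in>UNIV. norm (q k))"
      using that bary_le_1[OF that] by (intro sum_mono) (auto simp: triangle_def intro!: mult_left_le_one_le)
    finally show ?thesis .
  qed
  then have "bounded triangle" by (auto simp: bounded_iff)
  ultimately show ?thesis by (simp add: compact_eq_bounded_closed)
qed

lemma vertex_triangle: "q i \<in> triangle"
  using exhaust_3[of i] by (auto simp: triangle_def bary_vertex sum_3)

section \<open>The three contractions and their attractor\<close>

lemma dist_map: "dist (sg_map q i x) (sg_map q i y) = dist x y / 2"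
proof -
  have "sg_map q i x - sg_map q i y = (1/2) *\<^sub>R (x - y)"
    by (simp add: sg_map_def algebra_simps)
  then show ?thesis by (simp add: dist_norm)
qed

lemma inj_map: "sg_map q i x = sg_map q i y \<longleftrightarrow> x = y"
  by (simp add: sg_map_def)

lemma continuous_map [continuous_intros]: "continuous_on A (sg_map q i)"
  unfolding sg_map_def by (intro continuous_intros)

lemma map_vertex: "sg_map q i (q i) = q i"
  by (simp add: sg_map_def scaleR_2[symmetric])

text \<open>Pulling a point of \<open>K\<close> back through n maps and pushing a point of
  \<open>L\<close> forward through the same maps brings the two within \<open>C / 2^n\<close>;
  closedness of \<open>L\<close> finishes. The one-sided inclusions serve both the uniqueness of the
  attractor and the membership of the vertices.\<close>

lemma hutch_attractor_subset:
  assumes "bounded K" "K \<subseteq> hutch K" "closed L" "L \<noteq> {}" "hutch L \<subseteq> L"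
  shows "K \<subseteq> L"
proof
  obtain y0 where y0: "y0 \<in> L" using assms by auto
  obtain C where C: "\<And>x. x \<in> K \<Longrightarrow> dist x y0 \<le> C"
    using assms(1) by (metis bounded_any_center dist_commute)
  have approx: "\<forall>x\<in>K. \<exists>y\<in>L. dist x y \<le> C / 2^n" for n
  proof (induction n)
    case 0 then show ?case using C y0 by auto
  next
    case (Suc n)
    show ?case
    proof
      fix x assume "x \<in> K"
      then obtain i x' where x: "x = sg_map q i x'" "x' \<in> K" using assms(2) by blast
      then obtain y where y: "y \<in> L" "dist x' y \<le> C / 2^n" using Suc by blast
      then have "sg_map q i y \<in> L" using assms(5) by blast
      then show "\<exists>y\<in>L. dist x y \<le> C / 2 ^ Suc n"
        using y(2) x(1) by (intro bexI[of _ "sg_map q i y"]) (auto simp: dist_map field_simps)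
    qed
  qed
  fix x assume x: "x \<in> K"
  show "x \<in> L"
  proof (rule closed_approachable[THEN iffD1, OF assms(3)], intro allI impI)
    fix e :: real assume "e > 0"
    have "(\<lambda>n. C / 2^n) \<longlonglongrightarrow> 0" by real_asymp
    then have "\<forall>\<^sub>F n in sequentially. C / 2^n < e" using \<open>e > 0\<close> by (rule order_tendstoD)
    then obtain n where "C / 2^n < e" by (auto simp: eventually_sequentially)
    then show "\<exists>y\<in>L. dist y x < e" using approx[of n] x
      by (metis dist_commute le_less_trans)
  qed
qed

text \<open>The attractor is the intersection of the decreasing compact iterates
  \<open>(hutch ^^ n) triangle\<close>, nonempty by compactness.\<close>

lemma hutch_attractor_exists:
  "\<exists>K. compact K \<and> K \<noteq> {} \<and> K = hutch K \<and> K \<subseteq> triangle"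
proof -
  define K where "K n = (hutch ^^ n) triangle" for n
  have K_Suc: "K (Suc n) = hutch (K n)" for n by (simp add: K_def)
  have dec: "K (Suc n) \<subseteq> K n" for n
  proof (induction n)
    case 0 show ?case using triangle_map by (auto simp: K_def)
  next
    case (Suc n) then show ?case unfolding K_Suc[of n] K_Suc[of "Suc n"] by blast
  qed
  have anti: "K n \<subseteq> K m" if "m \<le> n" for m n
    using lift_Suc_antimono_le[of K, OF dec that] .
  have comp: "compact (K n)" for n
  proof (induction n)
    case 0 show ?case by (simp add: K_def compact_triangle)
  next
    case (Suc n) then show ?case unfolding K_Suc
      by (intro compact_UN compact_continuous_image continuous_intros) auto
  qed
  have ne: "K n \<noteq> {}" for n
  proof (induction n)
    case 0 show ?case using vertex_triangle by (auto simp: K_def)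
  next
    case (Suc n) then show ?case unfolding K_Suc by auto
  qed
  define L where "L = (\<Inter>n. K n)"
  have "L \<noteq> {}" unfolding L_def by (rule compact_nest[OF comp ne anti])
  moreover have "compact L" unfolding L_def by (intro compact_Inter) (use comp in auto)
  moreover have "L \<subseteq> triangle" using INT_lower[of 0 UNIV K] by (simp add: L_def K_def)
  moreover have "hutch L \<subseteq> L"
  proof -
    have "hutch L \<subseteq> K n" for n
    proof -
      have "hutch L \<subseteq> K (Suc n)" unfolding K_Suc L_def by blast
      then show ?thesis using dec by blast
    qed
    then show ?thesis unfolding L_def by blast
  qed
  moreover have "L \<subseteq> hutch L"
  proof
    fix x assume x: "x \<in> L"
    have "\<exists>i. x \<in> sg_map q i ` K n" for n
      using x K_Suc[of n] unfolding L_def by blast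
    then obtain f where f: "\<And>n. x \<in> sg_map q (f n) ` K n" by metis
    \<comment> \<open>The index of the map may change with n. By pigeonhole one index occurs
      infinitely often; since the \<open>K n\<close> decrease, it serves every n, and injectivity
      yields one preimage for all n.\<close>
    have "\<exists>i. infinite {n. f n = i}"
    proof (rule ccontr)
      assume "\<not> ?thesis"
      then have "finite (\<Union>i. {n. f n = i})" by (intro finite_UN_I) auto
      moreover have "(\<Union>i. {n. f n = i}) = UNIV" by auto
      ultimately show False by simp
    qed
    then obtain i where i: "infinite {n. f n = i}" by auto
    have "x \<in> sg_map q i ` K n" for n
    proof -
      obtain m where "m \<ge> n" "f m = i" using i by (auto simp: infinite_nat_iff_unbounded_le)
      then show ?thesis using f[of m] anti[of n m] by blast
    qed
    then obtain y where y: "x = sg_map q i y" by blast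
    have "y \<in> K n" for n
      using \<open>\<And>n. x \<in> sg_map q i ` K n\<close>[of n] y inj_map by auto
    then have "y \<in> L" unfolding L_def by blast
    then show "x \<in> hutch L" using y by blast
  qed
  ultimately show ?thesis by blast
qed

lemma SG_properties:
  shows compact_SG: "compact (SG q)" and SG_nonempty: "SG q \<noteq> {}"
    and SG_fixed: "SG q = hutch (SG q)" and SG_triangle: "SG q \<subseteq> triangle"
proof -
  obtain K where K: "compact K" "K \<noteq> {}" "K = hutch K" "K \<subseteq> triangle"
    using hutch_attractor_exists by blast
  \<comment> \<open>Comparison of two attractors in both directions gives the uniqueness that
    \<open>THE\<close> requires.\<close>
  have "SG q = K" unfolding SG_def
  proof (rule the_equality)
    fix L assume L: "compact L \<and> L \<noteq> {} \<and> L = hutch L"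
    have "L \<subseteq> K"
      by (rule hutch_attractor_subset[OF compact_imp_bounded equalityD1 compact_imp_closed K(2) equalityD2])
        (use L K in blast)+
    moreover have "K \<subseteq> L"
      by (rule hutch_attractor_subset[OF compact_imp_bounded equalityD1 compact_imp_closed _ equalityD2])
        (use L K in blast)+
    ultimately show "L = K" by simp
  qed (use K in blast)
  then show "compact (SG q)" "SG q \<noteq> {}" "SG q = hutch (SG q)" "SG q \<subseteq> triangle"
    using K by auto
qed

lemma SG_map: "x \<in> SG q \<Longrightarrow> sg_map q i x \<in> SG q"
  using SG_fixed by blast

lemma vertex_SG: "q i \<in> SG q"
proof -
  have "{q i} \<subseteq> SG q"
  proof (rule hutch_attractor_subset)
    show "{q i} \<subseteq> hutch {q i}" by (auto simp: map_vertex intro!: exI[of _ i])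
    show "hutch (SG q) \<subseteq> SG q" using SG_map by blast
  qed (auto simp: compact_SG compact_imp_closed SG_nonempty)
  then show ?thesis by simp
qed

section \<open>How cells meet, cover and shrink\<close>

lemma bary_eq_1:
  assumes "x \<in> triangle" "bary i x = 1" shows "x = q i"
proof -
  have "(\<Sum>k\<in>UNIV - {i}. bary k x) = 0"
    using bary_sum[of x] assms(2) by (simp add: sum.remove[of UNIV i])
  then have "bary k x = 0" if "k \<noteq> i" for k
    using that assms(1) by (subst (asm) sum_nonneg_eq_0_iff) (auto simp: triangle_def)
  then have "bary k x = (if k = i then 1 else 0)" for k using assms(2) by auto
  then have "bary k x = bary k (q i)" for k by (simp add: bary_vertex)
  then show ?thesis using assms(1) vertex_triangle[of i] by (simp add: triangle_def)
qed

text \<open>Points of cell \<open>j\<close> have \<open>bary j\<close> at least 1/2, and on cell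
  \<open>i\<close> this coordinate is \<open>bary j x / 2\<close>, so \<open>bary j x\<close> must
  be 1. Hence distinct cells touch only at a midpoint.\<close>

lemma map_eq_map:
  assumes "x \<in> triangle" "y \<in> triangle" "i \<noteq> j" "sg_map q i x = sg_map q j y"
  shows "x = q j"
proof -
  have "bary j x / 2 = (bary j y + 1) / 2"
    using assms(3) arg_cong[OF assms(4), of "bary j"] by (simp add: bary_map)
  then have "bary j x \<ge> 1" using assms(2) by (auto simp: triangle_def)
  then show ?thesis using bary_eq_1[OF assms(1)] bary_le_1[OF assms(1), of j] by simp
qed

lemma map_vertex_commute: "sg_map q i (q j) = sg_map q j (q i)"
  by (simp add: sg_map_def add.commute)

lemma word_SG: "x \<in> SG q \<Longrightarrow> sg_word q w x \<in> SG q"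
  by (induction w) (auto simp: SG_map)

lemma dist_word: "dist (sg_word q w x) (sg_word q w y) = dist x y / 2 ^ length w"
  by (induction w) (auto simp: dist_map)

lemma SG_word_cover: "x \<in> SG q \<Longrightarrow> \<exists>w. length w = m \<and> x \<in> sg_word q w ` SG q"
proof (induction m arbitrary: x)
  case 0 then show ?case by auto
next
  case (Suc m)
  then obtain i y where y: "x = sg_map q i y" "y \<in> SG q" using SG_fixed by blast
  from Suc.IH[OF y(2)] obtain w where "length w = m" "y \<in> sg_word q w ` SG q" by blast
  then show ?case using y(1) by (intro exI[of _ "i # w"]) auto
qed

lemma small_cells:
  assumes "e > 0"
  shows "\<exists>m. \<forall>w. length w = m \<longrightarrow>
    (\<forall>x\<in>sg_word q w ` SG q. \<forall>y\<in>sg_word q w ` SG q. dist x y < e)"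
proof -
  define D where "D = diameter (SG q)"
  have "(\<lambda>m. D / 2^m) \<longlonglongrightarrow> 0" by real_asymp
  then have "\<forall>\<^sub>F m in sequentially. D / 2^m < e" using assms by (rule order_tendstoD)
  then obtain m where m: "D / 2^m < e" by (auto simp: eventually_sequentially)
  have "dist (sg_word q w x) (sg_word q w y) < e"
    if "length w = m" "x \<in> SG q" "y \<in> SG q" for w x y
  proof -
    have "dist x y \<le> D" unfolding D_def
      using diameter_bounded_bound[OF compact_imp_bounded[OF compact_SG]] that by blast
    then have "dist x y / 2^m \<le> D / 2^m" by (intro divide_right_mono) auto
    then show ?thesis using m that(1) by (simp add: dist_word)
  qed
  then show ?thesis by blast
qed

section \<open>The graph energies\<close>

definition edges :: "nat \<Rightarrow> ((real^2) \<times> (real^2)) set" where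
  "edges m = {(x, y). sg_adj q m x y}"

lemma edges_0: "edges 0 = {(q i, q j) | i j. i \<noteq> j}"
  by (auto simp: edges_def sg_adj_def V0_def inj_vertices) 

lemma edges_Suc: "edges (Suc m) = (\<Union>i. map_prod (sg_map q i) (sg_map q i) ` edges m)"
proof -
  have eq: "sg_adj q (Suc m) x y \<longleftrightarrow>
      (\<exists>i x' y'. x = sg_map q i x' \<and> y = sg_map q i y' \<and> sg_adj q m x' y')" for x y
  proof
    assume "sg_adj q (Suc m) x y"
    then obtain v a b where v: "length v = Suc m" "x = sg_word q v a" "y = sg_word q v b"
      "a \<in> V0 q" "b \<in> V0 q" "x \<noteq> y" unfolding sg_adj_def by blast
    then obtain i w where "v = i # w" "length w = m" by (auto simp: length_Suc_conv)
    then show "\<exists>i x' y'. x = sg_map q i x' \<and> y = sg_map q i y' \<and> sg_adj q m x' y'"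
      using v unfolding sg_adj_def
      by (intro exI[of _ i] exI[of _ "sg_word q w a"] exI[of _ "sg_word q w b"]) auto
  next
    assume "\<exists>i x' y'. x = sg_map q i x' \<and> y = sg_map q i y' \<and> sg_adj q m x' y'"
    then obtain i x' y' w where w: "x = sg_map q i x'" "y = sg_map q i y'" "x' \<noteq> y'"
      "length w = m" "x' \<in> sg_word q w ` V0 q" "y' \<in> sg_word q w ` V0 q"
      unfolding sg_adj_def by blast
    then show "sg_adj q (Suc m) x y" unfolding sg_adj_def
      by (intro conjI exI[of _ "i # w"]) (auto simp: inj_map)
  qed
  show ?thesis unfolding edges_def by (auto simp: image_iff eq) blast+
qed

lemma finite_edges: "finite (edges m)"
proof (induction m)
  case 0
  have "edges 0 \<subseteq> range q \<times> range q" unfolding edges_0 by auto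
  then show ?case by (rule finite_subset) auto
qed (simp add: edges_Suc)

lemma edges_SG: "edges m \<subseteq> SG q \<times> SG q"
proof (induction m)
  case 0 show ?case unfolding edges_0 using vertex_SG by auto
next
  case (Suc m) then show ?case unfolding edges_Suc using SG_map by auto
qed

lemma edges_neq: "(x, y) \<in> edges m \<Longrightarrow> x \<noteq> y"
  by (simp add: edges_def sg_adj_def)

text \<open>An edge has two distinct endpoints while two cells share at most one point, so no edge
  is counted in two cells.\<close>

lemma sum_edges_Suc:
  "(\<Sum>e\<in>edges (Suc m). f e) = (\<Sum>i\<in>UNIV. \<Sum>e\<in>edges m. f (map_prod (sg_map q i) (sg_map q i) e))"
proof -
  have disj: "map_prod (sg_map q i) (sg_map q i) ` edges m \<inter> map_prod (sg_map q j) (sg_map q j) ` edges m = {}"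
    if "i \<noteq> j" for i j
  proof (rule equals0I)
    fix e assume "e \<in> map_prod (sg_map q i) (sg_map q i) ` edges m \<inter> map_prod (sg_map q j) (sg_map q j) ` edges m"
    then obtain x y x' y' where e: "(x, y) \<in> edges m" "(x', y') \<in> edges m"
      "sg_map q i x = sg_map q j x'" "sg_map q i y = sg_map q j y'" by auto
    then have "x \<in> triangle" "x' \<in> triangle" "y \<in> triangle" "y' \<in> triangle"
      using edges_SG SG_triangle by blast+
    then have "x = q j" "y = q j" using map_eq_map that e(3,4) by blast+
    then show False using edges_neq e(1) by blast
  qed
  have inj: "inj_on (map_prod (sg_map q i) (sg_map q i)) A" for i A
    by (auto simp: inj_on_def inj_map)
  have "(\<Sum>e\<in>edges (Suc m). f e) = (\<Sum>i\<in>UNIV. \<Sum>e\<in>map_prod (sg_map q i) (sg_map q i) ` edges m. f e)"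
    unfolding edges_Suc by (rule sum.UNION_disjoint) (use finite_edges disj in auto)
  then show ?thesis by (simp add: sum.reindex[OF inj])
qed

text \<open>The polarized form at level m. Its linearity is immediate from the sum, whereas
  \<open>energy_form\<close> is built from limits of energies; linear relations are therefore proved
  here and passed to the limit.\<close>

definition graph_form :: "nat \<Rightarrow> (real^2 \<Rightarrow> real) \<Rightarrow> (real^2 \<Rightarrow> real) \<Rightarrow> real" where
  "graph_form m u v = (5/3)^m * ((1/2) * (\<Sum>(x, y)\<in>edges m. (u x - u y) * (v x - v y)))"

lemma graph_energy_form: "graph_energy q m u = graph_form m u u"
  by (simp add: graph_energy_def graph_form_def edges_def power2_eq_square)

lemma graph_form_add: "graph_form m (\<lambda>x. u x + u' x) v = graph_form m u v + graph_form m u' v"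
  unfolding graph_form_def
  by (simp add: case_prod_unfold algebra_simps sum.distrib sum_subtractf)

lemma graph_form_scale: "graph_form m (\<lambda>x. c * u x) v = c * graph_form m u v"
  unfolding graph_form_def sum_distrib_left
  by (intro sum.cong) (auto simp: algebra_simps)

lemma graph_form_sum:
  "finite A \<Longrightarrow> graph_form m (\<lambda>x. \<Sum>i\<in>A. c i * u i x) v = (\<Sum>i\<in>A. c i * graph_form m (u i) v)"
proof (induction A rule: finite_induct)
  case empty then show ?case by (simp add: graph_form_def)
next
  case (insert a A) then show ?case by (simp add: graph_form_add graph_form_scale)
qed

lemma graph_form_cong:
  assumes "\<And>x. x \<in> SG q \<Longrightarrow> u x = u' x" "\<And>x. x \<in> SG q \<Longrightarrow> v x = v' x"
  shows "graph_form m u v = graph_form m u' v'"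
proof -
  have "(\<Sum>(x, y)\<in>edges m. (u x - u y) * (v x - v y)) = (\<Sum>(x, y)\<in>edges m. (u' x - u' y) * (v' x - v' y))"
    by (intro sum.cong) (use edges_SG[of m] assms in auto)
  then show ?thesis by (simp add: graph_form_def)
qed

lemma graph_energy_cong:
  "(\<And>x. x \<in> SG q \<Longrightarrow> u x = v x) \<Longrightarrow> graph_energy q m u = graph_energy q m v"
  unfolding graph_energy_form by (rule graph_form_cong)

lemma graph_energy_nonneg: "graph_energy q m u \<ge> 0"
  unfolding graph_energy_def by (intro mult_nonneg_nonneg sum_nonneg) auto

text \<open>Parallelogram law. As both terms on the left are nonnegative, it bounds each by the
  energies of \<open>u\<close> and \<open>v\<close>, so sums and differences keep finite
  energy.\<close>

lemma graph_energy_plus_minus: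
  "graph_energy q m (\<lambda>x. u x + v x) + graph_energy q m (\<lambda>x. u x - v x)
     = 2 * graph_energy q m u + 2 * graph_energy q m v"
proof -
  have "(\<Sum>(x, y)\<in>edges m. (u x + v x - (u y + v y))\<^sup>2) + (\<Sum>(x, y)\<in>edges m. (u x - v x - (u y - v y))\<^sup>2)
    = 2 * (\<Sum>(x, y)\<in>edges m. (u x - u y)\<^sup>2) + 2 * (\<Sum>(x, y)\<in>edges m. (v x - v y)\<^sup>2)"
    unfolding sum_distrib_left sum.distrib[symmetric]
    by (intro sum.cong) (auto simp: power2_eq_square algebra_simps)
  then show ?thesis unfolding graph_energy_def edges_def[symmetric]
    by (metis (no_types, lifting) distrib_left mult.left_commute)
qed

lemma graph_form_polarization:
  "graph_form m u v = (graph_energy q m (\<lambda>x. u x + v x) - graph_energy q m (\<lambda>x. u x - v x)) / 4"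
proof -
  have "(\<Sum>(x, y)\<in>edges m. (u x + v x - (u y + v y))\<^sup>2) - (\<Sum>(x, y)\<in>edges m. (u x - v x - (u y - v y))\<^sup>2)
    = 4 * (\<Sum>(x, y)\<in>edges m. (u x - u y) * (v x - v y))"
    unfolding sum_distrib_left sum_subtractf[symmetric]
    by (intro sum.cong) (auto simp: power2_eq_square algebra_simps)
  moreover have "c * (1/2 * C) = (c * (1/2 * A) - c * (1/2 * B)) / 4" if "A - B = 4 * C" for A B C c :: real
  proof -
    have "A = B + 4 * C" using that by simp
    then show ?thesis by (simp add: algebra_simps)
  qed
  ultimately show ?thesis unfolding graph_energy_def graph_form_def edges_def[symmetric] by blast
qed

section \<open>Monotonicity of the graph energies and their limit\<close>

definition triangle_energy :: "(3 \<Rightarrow> real) \<Rightarrow> real" where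
  "triangle_energy a = (a 1 - a 2)\<^sup>2 + (a 2 - a 3)\<^sup>2 + (a 3 - a 1)\<^sup>2"

lemma graph_energy_0: "graph_energy q 0 u = triangle_energy (\<lambda>i. u (q i))"
proof -
  have e: "edges 0 = (\<lambda>(i, j). (q i, q j)) ` {(i, j). i \<noteq> j}"
    unfolding edges_0 by auto
  have "inj_on (\<lambda>(i, j). (q i, q j)) A" for A by (auto simp: inj_on_def inj_vertices)
  then have "(\<Sum>(x, y)\<in>edges 0. (u x - u y)\<^sup>2) = (\<Sum>(i, j)\<in>{(i, j). i \<noteq> j}. (u (q i) - u (q j))\<^sup>2)"
    unfolding e by (simp add: sum.reindex case_prod_unfold)
  also have "\<dots> = (\<Sum>(i, j)\<in>UNIV \<times> UNIV. (u (q i) - u (q j))\<^sup>2)"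
    by (intro sum.mono_neutral_left) auto
  also have "\<dots> = 2 * triangle_energy (\<lambda>i. u (q i))"
    unfolding sum.cartesian_product[symmetric] triangle_energy_def
    by (simp add: sum_3 power2_eq_square algebra_simps)
  finally show ?thesis unfolding graph_energy_def edges_def[symmetric] by simp
qed

lemma graph_energy_Suc:
  "graph_energy q (Suc m) u = 5/3 * (\<Sum>i\<in>UNIV. graph_energy q m (\<lambda>x. u (sg_map q i x)))"
proof -
  have "(\<Sum>(x, y)\<in>edges (Suc m). (u x - u y)\<^sup>2) =
     (\<Sum>i\<in>UNIV. \<Sum>(x, y)\<in>edges m. (u (sg_map q i x) - u (sg_map q i y))\<^sup>2)"
    by (simp add: sum_edges_Suc case_prod_unfold)
  then show ?thesis unfolding graph_energy_def edges_def[symmetric]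
    by (simp add: sum_3 algebra_simps)
qed

text \<open>Here \<open>b i j\<close> is the value at the corner \<open>q j\<close> of cell
  \<open>i\<close>, symmetric because cells share midpoints. The harmonic extension is the critical
  point, so no terms linear in the deviations remain, and the factor 5/3 cancels the terms in the
  vertex values alone; a sum of squares is left.\<close>

lemma triangle_energy_le_midpoints:
  assumes "\<And>i j. b i j = b j i"
  shows "triangle_energy (\<lambda>i. b i i) \<le> 5/3 * (\<Sum>i\<in>UNIV. triangle_energy (b i))"
proof -
  define k l n x y z where xyz: "k = b 1 1" "l = b 2 2" "n = b 3 3" "x = b 2 3" "y = b 3 1" "z = b 1 2"
  \<comment> \<open>\<open>X, Y, Z\<close> are the deviations of the midpoint values from the harmonic extension.\<close>
  define X Y Z where XYZ: "X = x - (k + 2*l + 2*n) / 5" "Y = y - (2*k + l + 2*n) / 5" "Z = z - (2*k + 2*l + n) / 5"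
  have s: "b 3 2 = x" "b 1 3 = y" "b 2 1 = z" using assms xyz by auto
  have "5/3 * (\<Sum>i\<in>UNIV. triangle_energy (b i)) - triangle_energy (\<lambda>i. b i i)
    = 5/3 * (2 * (X\<^sup>2 + Y\<^sup>2 + Z\<^sup>2) + (X - Y)\<^sup>2 + (Y - Z)\<^sup>2 + (Z - X)\<^sup>2)"
    unfolding sum_3 triangle_energy_def s xyz[symmetric] XYZ
    by (simp add: field_simps power2_eq_square)
  also have "\<dots> \<ge> 0" by simp
  finally show ?thesis by simp
qed

text \<open>Refining a single triangle never lowers the renormalized energy; splitting off the
  outermost map carries this from level 0 to every level.\<close>

lemma graph_energy_mono: "graph_energy q m u \<le> graph_energy q (Suc m) u"
proof (induction m arbitrary: u)
  case 0
  have eq: "u (q i) = u (sg_map q i (q i))" for i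
    by (simp add: map_vertex)
  show ?case
    unfolding graph_energy_Suc graph_energy_0 eq
    by (rule triangle_energy_le_midpoints) (simp add: map_vertex_commute)
next
  case (Suc m)
  then show ?case unfolding graph_energy_Suc[of "Suc m"] graph_energy_Suc[of m]
    by (intro mult_left_mono sum_mono) auto
qed

lemma incseq_graph_energy: "incseq (\<lambda>m. graph_energy q m u)"
  by (intro incseq_SucI graph_energy_mono)

text \<open>Monotonicity turns the limit into a supremum, so finite energy means bounded graph
  energies.\<close>

lemma energy_eq_SUP: "energy q u = (SUP m. ereal (graph_energy q m u))"
  unfolding energy_def
  by (intro limI LIMSEQ_SUP) (use incseq_graph_energy[of u] in \<open>auto simp: incseq_def\<close>)

lemma energy_finite_iff: "energy q u < \<infinity> \<longleftrightarrow> (\<exists>C. \<forall>m. graph_energy q m u \<le> C)"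
proof
  assume *: "energy q u < \<infinity>"
  have "ereal (graph_energy q m u) \<le> energy q u" for m
    unfolding energy_eq_SUP by (rule SUP_upper) simp
  then show "\<exists>C. \<forall>m. graph_energy q m u \<le> C"
    using * by (cases "energy q u") auto
next
  assume "\<exists>C. \<forall>m. graph_energy q m u \<le> C"
  then obtain C where "\<And>m. graph_energy q m u \<le> C" by blast
  then have "energy q u \<le> ereal C" unfolding energy_eq_SUP by (intro SUP_least) simp
  then show "energy q u < \<infinity>" by (rule le_less_trans) simp
qed

lemma graph_energy_tendsto:
  assumes "energy q u < \<infinity>"
  shows "(\<lambda>m. graph_energy q m u) \<longlonglongrightarrow> real_of_ereal (energy q u)"
proof -
  have "(\<lambda>m. ereal (graph_energy q m u)) \<longlonglongrightarrow> energy q u"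
    unfolding energy_eq_SUP
    by (intro LIMSEQ_SUP) (use incseq_graph_energy[of u] in \<open>auto simp: incseq_def\<close>)
  moreover have "energy q u \<ge> 0" unfolding energy_eq_SUP
    by (rule SUP_upper2[of 0]) (simp_all add: graph_energy_nonneg)
  then have "energy q u = ereal (real_of_ereal (energy q u))"
    using assms by (cases "energy q u") auto
  ultimately show ?thesis by (metis lim_ereal)
qed

lemma dom_energy_add_diff:
  assumes "u \<in> dom_energy q" "v \<in> dom_energy q"
  shows "energy q (\<lambda>x. u x + v x) < \<infinity>" "energy q (\<lambda>x. u x - v x) < \<infinity>"
proof -
  obtain C D where C: "\<And>m. graph_energy q m u \<le> C" and D: "\<And>m. graph_energy q m v \<le> D"
    using assms energy_finite_iff[of u] energy_finite_iff[of v] unfolding dom_energy_def by blast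
  have "graph_energy q m (\<lambda>x. u x + v x) \<le> 2 * C + 2 * D"
    and "graph_energy q m (\<lambda>x. u x - v x) \<le> 2 * C + 2 * D" for m
    using C[of m] D[of m] graph_energy_plus_minus[of m u v]
      graph_energy_nonneg[of m "\<lambda>x. u x + v x"] graph_energy_nonneg[of m "\<lambda>x. u x - v x"] by linarith+
  then show "energy q (\<lambda>x. u x + v x) < \<infinity>" "energy q (\<lambda>x. u x - v x) < \<infinity>"
    unfolding energy_finite_iff by blast+
qed

lemma graph_form_tendsto:
  assumes "u \<in> dom_energy q" "v \<in> dom_energy q"
  shows "(\<lambda>m. graph_form m u v) \<longlonglongrightarrow> energy_form q u v"
  unfolding graph_form_polarization energy_form_def
  by (intro tendsto_intros graph_energy_tendsto dom_energy_add_diff assms) simp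

section \<open>Harmonic functions and splines\<close>

text \<open>The map \<open>2 x - q i\<close> inverts \<open>sg_map q i\<close>. A midpoint lies in
  two cells and \<open>SOME\<close> may pick either; \<open>compatible\<close> makes the choice
  immaterial.\<close>

definition glue :: "(3 \<Rightarrow> real^2 \<Rightarrow> real) \<Rightarrow> real^2 \<Rightarrow> real" where
  "glue u x = (let i = SOME i. x \<in> sg_map q i ` SG q in u i (2 *\<^sub>R x - q i))"

text \<open>The points \<open>sg_map q i (q j)\<close> and \<open>sg_map q j (q i)\<close> coincide,
  so this is agreement at the shared midpoints.\<close>

definition compatible :: "(3 \<Rightarrow> real^2 \<Rightarrow> real) \<Rightarrow> bool" where
  "compatible u \<longleftrightarrow> (\<forall>i j. u i (q j) = u j (q i))"

lemma glue_map:
  assumes "compatible u" "x \<in> SG q"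
  shows "glue u (sg_map q i x) = u i x"
proof -
  define j where "j = (SOME j. sg_map q i x \<in> sg_map q j ` SG q)"
  have "sg_map q i x \<in> sg_map q j ` SG q"
    unfolding j_def by (rule someI[of _ i]) (use assms(2) in blast)
  then obtain y where y: "y \<in> SG q" "sg_map q i x = sg_map q j y" by blast
  have "2 *\<^sub>R sg_map q j y - q j = y" by (simp add: sg_map_def)
  then have "glue u (sg_map q i x) = u j y"
    unfolding glue_def Let_def j_def[symmetric] by (simp add: y(2))
  also have "u j y = u i x"
  proof (cases "i = j")
    case True then show ?thesis using y inj_map by simp
  next
    case False
    \<comment> \<open>If the cell picked by \<open>SOME\<close> is not cell \<open>i\<close>, the
      point is the midpoint that both cells share.\<close>
    then have "x = q j" "y = q i"
      using map_eq_map assms(2) y SG_triangle by (metis subsetD)+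
    then show ?thesis using assms(1) by (simp add: compatible_def)
  qed
  finally show ?thesis .
qed

lemma glue_vertex:
  assumes "compatible u"
  shows "glue u (q i) = u i (q i)"
  using glue_map[OF assms vertex_SG, of i i] by (simp add: map_vertex)

lemma continuous_glue:
  assumes "compatible u" "\<And>i. continuous_on (SG q) (u i)"
  shows "continuous_on (SG q) (glue u)"
proof -
  have "continuous_on (\<Union>i\<in>UNIV. sg_map q i ` SG q) (glue u)"
  proof (rule continuous_on_closed_Union)
    fix i
    show "closed (sg_map q i ` SG q)"
      by (intro compact_imp_closed compact_continuous_image continuous_intros compact_SG)
    have "continuous_on (sg_map q i ` SG q) (\<lambda>x. u i (2 *\<^sub>R x - q i))"
      by (rule continuous_on_compose2[OF assms(2)[of i]])
        (auto intro!: continuous_intros simp: sg_map_def)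
    moreover have "u i (2 *\<^sub>R x - q i) = glue u x" if x: "x \<in> sg_map q i ` SG q" for x
    proof -
      obtain y where y: "x = sg_map q i y" "y \<in> SG q" using x by blast
      have "2 *\<^sub>R x - q i = y" by (simp add: y(1) sg_map_def)
      then show ?thesis using glue_map[OF assms(1) y(2)] y(1) by simp
    qed
    ultimately show "continuous_on (sg_map q i ` SG q) (glue u)"
      by (rule continuous_on_eq)
  qed auto
  then show ?thesis using SG_fixed by simp
qed

lemma graph_energy_glue:
  assumes "compatible u"
  shows "graph_energy q (Suc m) (glue u) = 5/3 * (\<Sum>i\<in>UNIV. graph_energy q m (u i))"
  unfolding graph_energy_Suc
  by (intro arg_cong[of _ _ "(*) (5/3)"] sum.cong refl graph_energy_cong glue_map assms)

lemma glue_dom_energy: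
  assumes "compatible u" "\<And>i. u i \<in> dom_energy q"
  shows "glue u \<in> dom_energy q"
proof -
  have "\<exists>C. \<forall>m. graph_energy q m (u i) \<le> C" for i
    using assms(2)[of i] energy_finite_iff[of "u i"] unfolding dom_energy_def by blast
  then obtain C where C: "\<And>i m. graph_energy q m (u i) \<le> C i" by metis
  have "graph_energy q m (glue u) \<le> 5/3 * (\<Sum>i\<in>UNIV. C i)" for m
  proof -
    \<comment> \<open>Going up one level makes the decomposition over the three cells available even
      at \<open>m = 0\<close>.\<close>
    have "graph_energy q m (glue u) \<le> graph_energy q (Suc m) (glue u)" by (rule graph_energy_mono)
    also have "\<dots> = 5/3 * (\<Sum>i\<in>UNIV. graph_energy q m (u i))"
      by (rule graph_energy_glue[OF assms(1)])
    also have "\<dots> \<le> 5/3 * (\<Sum>i\<in>UNIV. C i)" by (intro mult_left_mono sum_mono C) auto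
    finally show ?thesis .
  qed
  then have "energy q (glue u) < \<infinity>" unfolding energy_finite_iff by blast
  moreover have "continuous_on (SG q) (glue u)"
    using assms by (intro continuous_glue) (auto simp: dom_energy_def)
  ultimately show ?thesis by (simp add: dom_energy_def)
qed

text \<open>
  The values at the vertices of cell \<open>i\<close> of the harmonic function with vertex values \<open>a\<close>:
  the minimizer of the energy has the value \<open>(2 a\<^sub>i + 2 a\<^sub>j + a\<^sub>k) / 5\<close> at the midpoint of \<open>q\<^sub>i\<close> and \<open>q\<^sub>j\<close>.
\<close>
definition harm_restrict :: "(3 \<Rightarrow> real) \<Rightarrow> 3 \<Rightarrow> 3 \<Rightarrow> real" where
  "harm_restrict a i j = (if i = j then a i else (a i + a j + (\<Sum>k\<in>UNIV. a k)) / 5)"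

lemma harm_restrict_commute: "harm_restrict a i j = harm_restrict a j i"
  by (auto simp: harm_restrict_def)

text \<open>Equality case of \<open>triangle_energy_le_midpoints\<close>; it keeps the energy of a
  harmonic function the same at every level.\<close>

lemma harm_restrict_energy:
  "5/3 * (\<Sum>i\<in>UNIV. triangle_energy (harm_restrict a i)) = triangle_energy a"
  by (simp add: triangle_energy_def harm_restrict_def sum_3 power2_eq_square field_simps)

lemma harm_restrict_range:
  assumes "\<And>k. a k \<in> {l..h}" shows "harm_restrict a i j \<in> {l..h}"
  using assms[of 1] assms[of 2] assms[of 3] assms[of i] assms[of j]
  by (auto simp: harm_restrict_def sum_3)

lemma harm_restrict_osc:
  assumes "\<And>j k. \<bar>a j - a k\<bar> \<le> d"
  shows "\<bar>harm_restrict a i j - harm_restrict a i k\<bar> \<le> 3/5 * d"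
proof -
  \<comment> \<open>For \<open>j = i\<close> and \<open>k\<close> different from \<open>i\<close>,
    five times the difference is this quantity plus \<open>a i - a k\<close>, hence at most
    \<open>3 * d\<close> in size; if neither index is \<open>i\<close>, the difference is just
    \<open>(a j - a k) / 5\<close>.\<close>
  have "\<bar>3 * a i - (\<Sum>l\<in>UNIV. a l)\<bar> \<le> 2 * d"
    using assms[of 1 2] assms[of 2 3] assms[of 3 1] exhaust_3[of i] by (auto simp: sum_3)
  then show ?thesis
    using assms[of i j] assms[of i k] assms[of j k]
    by (auto simp: harm_restrict_def abs_le_iff) (simp_all add: field_simps abs_le_iff)
qed

text \<open>The harmonic rule fixes the values at the vertices of the cells of level n, with affine
  interpolation inside these cells; the affine start keeps every stage continuous. The recursion
  peels off the outermost map, as \<open>glue\<close> does.\<close>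

primrec harm_approx :: "nat \<Rightarrow> (3 \<Rightarrow> real) \<Rightarrow> real^2 \<Rightarrow> real" where
  "harm_approx 0 a = (\<lambda>x. \<Sum>k\<in>UNIV. a k * bary k x)"
| "harm_approx (Suc n) a = glue (\<lambda>i. harm_approx n (harm_restrict a i))"

lemma harm_approx_vertex: "harm_approx n a (q j) = a j"
proof (induction n arbitrary: a j)
  case 0 then show ?case using exhaust_3[of j] by (auto simp: bary_vertex sum_3)
next
  case (Suc n)
  then show ?case
    by (simp add: glue_vertex compatible_def harm_restrict_commute) (simp add: harm_restrict_def)
qed

lemma compatible_harm_approx: "compatible (\<lambda>i. harm_approx n (harm_restrict a i))"
  by (simp add: compatible_def harm_approx_vertex harm_restrict_commute)

lemma harm_approx_map:
  "x \<in> SG q \<Longrightarrow> harm_approx (Suc n) a (sg_map q i x) = harm_approx n (harm_restrict a i) x"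
  unfolding harm_approx.simps
  by (rule glue_map[OF compatible_harm_approx])

lemma continuous_harm_approx: "continuous_on (SG q) (harm_approx n a)"
proof (induction n arbitrary: a)
  case 0 show ?case by (auto intro!: continuous_intros)
next
  case (Suc n)
  then show ?case unfolding harm_approx.simps
    by (intro continuous_glue compatible_harm_approx)
qed

text \<open>Maximum principle: the barycentric weights at stage 0 and the weights 2/5, 2/5, 1/5 at
  each midpoint are convex.\<close>

lemma harm_approx_range:
  assumes "x \<in> SG q" "\<And>k. a k \<in> {l..h}" shows "harm_approx n a x \<in> {l..h}"
  using assms
proof (induction n arbitrary: a x)
  case 0
  have nn: "0 \<le> bary k x" for k using 0 SG_triangle by (auto simp: triangle_def)
  have "(\<Sum>k\<in>UNIV. l * bary k x) \<le> (\<Sum>k\<in>UNIV. a k * bary k x)"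
       "(\<Sum>k\<in>UNIV. a k * bary k x) \<le> (\<Sum>k\<in>UNIV. h * bary k x)"
    using 0 nn by (auto intro!: sum_mono mult_right_mono)
  then show ?case by (simp add: sum_distrib_left[symmetric] bary_sum)
next
  case (Suc n)
  then obtain i y where y: "x = sg_map q i y" "y \<in> SG q" using SG_fixed by blast
  show ?case unfolding y(1) harm_approx_map[OF y(2)]
    by (rule Suc.IH[OF y(2)]) (rule harm_restrict_range[OF Suc.prems(2)])
qed

text \<open>Each of the n common levels shrinks the oscillation of the vertex values by 3/5; after
  them both functions lie between the smallest and the largest vertex value that remains.\<close>

lemma harm_approx_dist:
  assumes "x \<in> SG q" "\<And>j k. \<bar>a j - a k\<bar> \<le> d"
  shows "\<bar>harm_approx (n + p) a x - harm_approx n a x\<bar> \<le> (3/5)^n * d"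
  using assms
proof (induction n arbitrary: a x d)
  case 0
  have "\<exists>l h. (\<forall>k. a k \<in> {l..h}) \<and> h - l \<le> d"
  proof -
    have "Min (range a) \<in> range a" "Max (range a) \<in> range a" by (intro Min_in Max_in; simp)+
    then obtain j k where "Min (range a) = a j" "Max (range a) = a k" by (elim rangeE)
    then have "Max (range a) - Min (range a) \<le> d" using 0(2)[of k j] by simp
    then show ?thesis by (intro exI[of _ "Min (range a)"] exI[of _ "Max (range a)"]) auto
  qed
  then obtain l h where lh: "\<And>k. a k \<in> {l..h}" "h - l \<le> d" by blast
  show ?case using harm_approx_range[OF 0(1), of a l h "0 + p"] harm_approx_range[OF 0(1), of a l h 0] lh
    by (auto simp: abs_if simp del: harm_approx.simps)
next
  case (Suc n)
  then obtain i y where y: "x = sg_map q i y" "y \<in> SG q" using SG_fixed by blast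
  \<comment> \<open>The bound \<open>d\<close> varies in the induction: the restricted vertex values
    oscillate by at most \<open>3/5 * d\<close>, which supplies the extra factor.\<close>
  have "\<bar>harm_approx (n + p) (harm_restrict a i) y - harm_approx n (harm_restrict a i) y\<bar> \<le> (3/5)^n * (3/5 * d)"
    by (rule Suc.IH[OF y(2)]) (rule harm_restrict_osc[OF Suc.prems(2)])
  then show ?case unfolding y(1) add_Suc harm_approx_map[OF y(2)] by (simp add: mult.commute mult.left_commute)
qed

section \<open>Harmonic functions as uniform limits\<close>

definition harm :: "(3 \<Rightarrow> real) \<Rightarrow> real^2 \<Rightarrow> real" where
  "harm a x = lim (\<lambda>n. harm_approx n a x)"

lemma harm_uniform_limit: "uniform_limit (SG q) (\<lambda>n. harm_approx n a) (harm a) sequentially"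
proof -
  define d where "d = (\<Sum>k\<in>UNIV. 2 * \<bar>a k\<bar>)"
  have bound: "\<bar>a j\<bar> \<le> (\<Sum>k\<in>UNIV. \<bar>a k\<bar>)" for j by (rule member_le_sum) auto
  have d: "\<bar>a j - a k\<bar> \<le> d" for j k
    unfolding d_def sum_distrib_left[symmetric] using bound[of j] bound[of k] by linarith
  have "uniformly_Cauchy_on (SG q) (\<lambda>n. harm_approx n a)"
  proof (rule uniformly_Cauchy_onI)
    fix e :: real assume "e > 0"
    \<comment> \<open>The factor 2 comes from comparing both stages with stage
      \<open>N\<close>.\<close>
    have "(\<lambda>n. 2 * ((3/5)^n * d)) \<longlonglongrightarrow> 0" by real_asymp
    then have "\<forall>\<^sub>F n in sequentially. 2 * ((3/5)^n * d) < e" using \<open>e > 0\<close> by (rule order_tendstoD)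
    then obtain N where N: "2 * ((3/5)^N * d) < e" by (auto simp: eventually_sequentially)
    have "dist (harm_approx m a x) (harm_approx n a x) < e" if "x \<in> SG q" "m \<ge> N" "n \<ge> N" for x m n
      using harm_approx_dist[OF that(1), where a = a, OF d, of N "m - N"]
        harm_approx_dist[OF that(1), where a = a, OF d, of N "n - N"] that N
      by (simp add: dist_real_def)
    then show "\<exists>M. \<forall>x\<in>SG q. \<forall>m\<ge>M. \<forall>n\<ge>M. dist (harm_approx m a x) (harm_approx n a x) < e" by blast
  qed
  then have "uniformly_convergent_on (SG q) (\<lambda>n. harm_approx n a)"
    by (rule Cauchy_uniformly_convergent)
  then have "uniform_limit (SG q) (\<lambda>n. harm_approx n a) (\<lambda>x. lim (\<lambda>n. harm_approx n a x)) sequentially"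
    by (simp add: uniformly_convergent_uniform_limit_iff)
  then show ?thesis by (simp add: harm_def[abs_def])
qed

lemma harm_tendsto: "x \<in> SG q \<Longrightarrow> (\<lambda>n. harm_approx n a x) \<longlonglongrightarrow> harm a x"
  using harm_uniform_limit by (rule tendsto_uniform_limitI)

lemma continuous_harm: "continuous_on (SG q) (harm a)"
  by (rule uniform_limit_theorem[OF _ harm_uniform_limit]) (simp_all add: continuous_harm_approx)

lemma harm_vertex: "harm a (q j) = a j"
  using harm_tendsto[OF vertex_SG] by (simp add: harm_approx_vertex LIMSEQ_const_iff)

lemma harm_map:
  assumes "x \<in> SG q" shows "harm a (sg_map q i x) = harm (harm_restrict a i) x"
proof -
  have "(\<lambda>n. harm_approx (Suc n) a (sg_map q i x)) \<longlonglongrightarrow> harm a (sg_map q i x)"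
    using harm_tendsto[OF SG_map[OF assms]] by (rule LIMSEQ_Suc)
  then have "(\<lambda>n. harm_approx n (harm_restrict a i) x) \<longlonglongrightarrow> harm a (sg_map q i x)"
    unfolding harm_approx_map[OF assms] .
  then show ?thesis using harm_tendsto[OF assms] LIMSEQ_unique by blast
qed

lemma harm_const:
  assumes "x \<in> SG q" "\<And>k. a k = c" shows "harm a x = c"
proof -
  have "harm_approx n a x = c" for n
    using harm_approx_range[OF assms(1), of a c c n] assms(2) by simp
  then show ?thesis using harm_tendsto[OF assms(1), of a] by (simp add: LIMSEQ_const_iff)
qed

lemma graph_energy_harm: "graph_energy q m (harm a) = triangle_energy a"
proof (induction m arbitrary: a)
  case 0 then show ?case by (simp add: graph_energy_0 harm_vertex)
next
  case (Suc m)
  have "graph_energy q m (\<lambda>x. harm a (sg_map q i x)) = graph_energy q m (harm (harm_restrict a i))" for i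
    by (rule graph_energy_cong) (rule harm_map)
  then show ?case by (simp only: graph_energy_Suc Suc.IH harm_restrict_energy)
qed

lemma harm_dom_energy: "harm a \<in> dom_energy q"
proof -
  have "energy q (harm a) < \<infinity>" unfolding energy_finite_iff graph_energy_harm by blast
  then show ?thesis by (simp add: dom_energy_def continuous_harm)
qed

text \<open>The function is harmonic on each cell of level m with the vertex values of
  \<open>f\<close>, hence constant on a cell where these agree. The clause on the vertices
  \<open>q k\<close> lets the pieces fit together in the induction.\<close>

lemma exists_spline:
  "\<exists>u\<in>dom_energy q. (\<forall>k. u (q k) = f (q k)) \<and>
     (\<forall>w c. length w = m \<longrightarrow> (\<forall>k. f (sg_word q w (q k)) = c) \<longrightarrow> (\<forall>x\<in>SG q. u (sg_word q w x) = c))"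
proof (induction m arbitrary: f)
  case 0
  show ?case
    by (rule bexI[of _ "harm (\<lambda>k. f (q k))"]) (auto simp: harm_vertex harm_const harm_dom_energy)
next
  case (Suc m)
  \<comment> \<open>Cell \<open>i\<close> receives a spline for \<open>f\<close> composed with
    \<open>sg_map q i\<close>. As \<open>f\<close> is a single function on the plane, neighbouring
    pieces get the same value at their common midpoint.\<close>
  have "\<forall>i. \<exists>u\<in>dom_energy q. (\<forall>k. u (q k) = f (sg_map q i (q k))) \<and>
     (\<forall>w c. length w = m \<longrightarrow> (\<forall>k. f (sg_map q i (sg_word q w (q k))) = c) \<longrightarrow> (\<forall>x\<in>SG q. u (sg_word q w x) = c))"
    using Suc.IH[of "\<lambda>x. f (sg_map q _ x)"] by blast
  then obtain u where dom: "\<And>i. u i \<in> dom_energy q"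
    and vert: "\<And>i k. u i (q k) = f (sg_map q i (q k))"
    and cell: "\<And>i w c x. length w = m \<Longrightarrow> (\<forall>k. f (sg_map q i (sg_word q w (q k))) = c) \<Longrightarrow> x \<in> SG q
      \<Longrightarrow> u i (sg_word q w x) = c"
    by metis
  have match: "compatible u" by (simp add: compatible_def vert map_vertex_commute)
  show ?case
  proof (intro bexI[of _ "glue u"] conjI allI impI ballI)
    show "glue u \<in> dom_energy q" by (rule glue_dom_energy[OF match dom])
    fix k
    show "glue u (q k) = f (q k)"
      by (simp add: glue_vertex[OF match] vert map_vertex)
  next
    fix w c x assume w: "length w = Suc m" "\<forall>k. f (sg_word q w (q k)) = c" and x: "x \<in> SG q"
    then obtain i v where v: "w = i # v" "length v = m" by (auto simp: length_Suc_conv)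
    then show "glue u (sg_word q w x) = c"
      using glue_map[OF match word_SG[OF x]] cell[OF v(2) _ x] w(2) by simp
  qed
qed

lemma dom_energy_separates:
  assumes "finite S" "S \<subseteq> SG q" "p \<in> SG q" "p \<notin> S"
  shows "\<exists>u\<in>dom_energy q. u p = 1 \<and> (\<forall>y\<in>S. u y = 0)"
proof -
  obtain e where e: "e > 0" "\<And>y. y \<in> S \<Longrightarrow> dist p y \<ge> e"
    using finite_set_avoid[OF assms(1), of p] assms(4) by (metis)
  obtain m where "\<forall>w. length w = m \<longrightarrow> (\<forall>x\<in>sg_word q w ` SG q. \<forall>y\<in>sg_word q w ` SG q. dist x y < e / 2)"
    using small_cells[OF half_gt_zero[OF e(1)]] by (elim exE)
  then have m: "dist x y < e / 2"
    if "length w = m" "x \<in> sg_word q w ` SG q" "y \<in> sg_word q w ` SG q" for w x y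
    using that by blast
  \<comment> \<open>Vertices of an m-cell containing \<open>p\<close> are closer than
    \<open>e / 2\<close> to \<open>p\<close>. Those of an m-cell containing a point of
    \<open>S\<close> are at least \<open>e / 2\<close> away, since that point has distance at least
    \<open>e\<close>. So \<open>f\<close> is constant on either kind of vertex set.\<close>
  define f where "f y = (if dist p y < e / 2 then 1 else 0 :: real)" for y
  obtain u where u: "u \<in> dom_energy q"
    and const: "\<forall>w c. length w = m \<longrightarrow> (\<forall>k. f (sg_word q w (q k)) = c) \<longrightarrow> (\<forall>x\<in>SG q. u (sg_word q w x) = c)"
    using exists_spline[of f m] by (elim bexE conjE)
  have cell: "u x = c" if "length w = m" "\<And>k. f (sg_word q w (q k)) = c" "x \<in> sg_word q w ` SG q" for w c x
    using const that by blast
  have "u p = 1"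
  proof -
    obtain w where w: "length w = m" "p \<in> sg_word q w ` SG q" using SG_word_cover[OF assms(3)] by blast
    have "f (sg_word q w (q k)) = 1" for k
      unfolding f_def using m[OF w imageI[OF vertex_SG]] by (rule if_P)
    then show ?thesis using cell w by blast
  qed
  moreover have "u y = 0" if "y \<in> S" for y
  proof -
    obtain w where w: "length w = m" "y \<in> sg_word q w ` SG q" using SG_word_cover assms(2) \<open>y \<in> S\<close> by blast
    have "dist p (sg_word q w (q k)) \<ge> e / 2" for k
      using m[OF w imageI[OF vertex_SG[of k]]] e(2)[OF that]
        dist_triangle[of p y "sg_word q w (q k)"] by (simp add: dist_commute)
    then show ?thesis by (intro cell[OF w(1) _ w(2)]) (simp add: f_def not_less)
  qed
  ultimately show ?thesis using u by blast
qed

section \<open>Linear independence of the Green functions\<close>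

lemma set_integrable_continuous_SG:
  fixes f :: "real^2 \<Rightarrow> real"
  assumes "sg_measure q \<mu>" "continuous_on (SG q) f"
  shows "set_integrable \<mu> (SG q) f"
proof -
  interpret prob_space \<mu> using assms(1) by (simp add: sg_measure_def)
  have sets: "sets \<mu> = sets borel" using assms(1) by (simp add: sg_measure_def)
  have "SG q \<in> sets borel" using compact_SG by (simp add: borel_compact)
  then have "(\<lambda>x. indicat_real (SG q) x *\<^sub>R f x) \<in> borel_measurable borel"
    using assms(2) by (rule borel_measurable_continuous_on_indicator)
  then have meas: "(\<lambda>x. indicat_real (SG q) x *\<^sub>R f x) \<in> borel_measurable \<mu>"
    by (simp add: measurable_cong_sets[OF sets refl])
  have "bounded (f ` SG q)"
    by (intro compact_imp_bounded compact_continuous_image assms(2) compact_SG)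
  then obtain B where B: "B > 0" "\<And>x. x \<in> SG q \<Longrightarrow> norm (f x) \<le> B"
    unfolding bounded_pos by blast
  then have "norm (indicat_real (SG q) x *\<^sub>R f x) \<le> B" for x
    by (auto simp: indicator_def)
  then show ?thesis unfolding set_integrable_def
    by (intro integrable_const_bound[OF _ meas, where B = B] AE_I2)
qed

text \<open>If \<open>f x > 0\<close>, continuity keeps \<open>f\<close> at or above
  \<open>f x / 2\<close> on a small cell containing \<open>x\<close>, whose measure
  \<open>(1/3)^m\<close> is positive; the integral would then be positive.\<close>

lemma integral_eq_0_imp_eq_0:
  fixes f :: "real^2 \<Rightarrow> real"
  assumes \<mu>: "sg_measure q \<mu>" and cont: "continuous_on (SG q) f"
    and nn: "\<And>y. y \<in> SG q \<Longrightarrow> f y \<ge> 0" and int: "(LINT y:SG q|\<mu>. f y) = 0" and x: "x \<in> SG q"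
  shows "f x = 0"
proof (rule ccontr)
  assume "f x \<noteq> 0"
  then have pos: "f x > 0" using nn[OF x] by simp
  interpret prob_space \<mu> using \<mu> by (simp add: sg_measure_def)
  have sets: "sets \<mu> = sets borel" using \<mu> by (simp add: sg_measure_def)
  obtain d where d: "d > 0" "\<And>y. y \<in> SG q \<Longrightarrow> dist y x < d \<Longrightarrow> dist (f y) (f x) < f x / 2"
    using cont x half_gt_zero[OF pos] unfolding continuous_on_iff by metis
  obtain m where m: "\<forall>w. length w = m \<longrightarrow> (\<forall>x\<in>sg_word q w ` SG q. \<forall>y\<in>sg_word q w ` SG q. dist x y < d)"
    using small_cells[OF d(1)] by (elim exE)
  obtain w where w: "length w = m" "x \<in> sg_word q w ` SG q" using SG_word_cover[OF x] by blast
  define A where "A = sg_word q w ` SG q"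
  have "continuous_on B (sg_word q v)" for v B
  proof (induction v)
    case Nil then show ?case by (simp add: id_def)
  next
    case (Cons i v) then show ?case unfolding sg_word.simps by (intro continuous_on_compose continuous_map)
  qed
  then have "compact A" unfolding A_def by (intro compact_continuous_image compact_SG)
  then have A: "A \<in> events" using sets by (simp add: borel_compact)
  have A_sub: "A \<subseteq> SG q" using word_SG by (auto simp: A_def)
  have ge: "f x / 2 \<le> f y" if "y \<in> A" for y
    using d(2)[of y] m w that A_sub unfolding A_def dist_real_def by (smt (verit) subsetD field_sum_of_halves)
  have "f x / 2 * prob A = (\<integral>y. f x / 2 * indicat_real A y \<partial>\<mu>)"
    using A by simp
  also have "\<dots> \<le> (LINT y:SG q|\<mu>. f y)"
    unfolding set_lebesgue_integral_def
  proof (rule integral_mono)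
    show "integrable \<mu> (\<lambda>y. indicat_real (SG q) y *\<^sub>R f y)"
      using set_integrable_continuous_SG[OF \<mu> cont] by (simp add: set_integrable_def)
    show "integrable \<mu> (\<lambda>y. f x / 2 * indicat_real A y)"
      using A by (intro integrable_mult_right) (simp add: integrable_indicator_iff emeasure_eq_measure)
    show "f x / 2 * indicat_real A y \<le> indicat_real (SG q) y *\<^sub>R f y" for y
      using ge[of y] nn[of y] A_sub by (auto simp: indicator_def)
  qed
  finally have "f x / 2 * prob A \<le> 0" using int by simp
  moreover have "prob A = (1/3) ^ m"
    using \<mu> w(1) by (simp add: sg_measure_def A_def)
  then have "prob A > 0" by simp
  ultimately show False using pos by (simp add: mult_le_0_iff)
qed

section \<open>The Dirichlet Green's function\<close>

lemma green_dom: "dirichlet_green q G \<Longrightarrow> y \<in> SG q \<Longrightarrow> (\<lambda>x. G x y) \<in> dom_energy0 q"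
  by (simp add: dirichlet_green_def)

lemma green_reproducing:
  "dirichlet_green q G \<Longrightarrow> y \<in> SG q \<Longrightarrow> v \<in> dom_energy0 q \<Longrightarrow> energy_form q (\<lambda>x. G x y) v = v y"
  by (simp add: dirichlet_green_def)

lemma energy_form_commute: "energy_form q u v = energy_form q v u"
proof -
  have "energy q (\<lambda>x. u x - v x) = energy q (\<lambda>x. v x - u x)"
    by (simp add: energy_def graph_energy_def power2_commute[of "v _ - u _ - _"] algebra_simps)
      (simp add: power2_eq_square algebra_simps)
  then show ?thesis by (simp add: energy_form_def add.commute)
qed

text \<open>The energy pairing of \<open>G(., y)\<close> with \<open>G(., z)\<close> is
  \<open>G y z\<close> by one reproducing property and \<open>G z y\<close> by the other. Symmetry
  then transfers continuity from the first argument to the second.\<close>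

lemma green_symmetric:
  assumes "dirichlet_green q G" "y \<in> SG q" "z \<in> SG q"
  shows "G y z = G z y"
  using green_reproducing[OF assms(1,2) green_dom[OF assms(1,3)]]
    green_reproducing[OF assms(1,3) green_dom[OF assms(1,2)]] energy_form_commute by metis

lemma green_vertex: "dirichlet_green q G \<Longrightarrow> p \<in> V0 q \<Longrightarrow> y \<in> SG q \<Longrightarrow> G p y = 0"
  using green_dom by (force simp: dom_energy0_def)

lemma continuous_green:
  assumes "dirichlet_green q G" "z \<in> SG q"
  shows "continuous_on (SG q) (G z)"
proof -
  have "continuous_on (SG q) (\<lambda>y. G y z)"
    using green_dom[OF assms] by (simp add: dom_energy0_def dom_energy_def)
  then show ?thesis by (rule continuous_on_eq) (rule green_symmetric[OF assms(1) _ assms(2)])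
qed

lemma green_independent:
  fixes x :: "'n::finite \<Rightarrow> real^2"
  assumes G: "dirichlet_green q G" and "inj x" "range x \<subseteq> SG q" "range x \<inter> V0 q = {}"
    and zero: "\<And>y. y \<in> SG q \<Longrightarrow> (\<Sum>i\<in>UNIV. c i * G (x i) y) = 0"
  shows "c k = 0"
proof -
  have xSG: "x i \<in> SG q" for i using assms(3) by auto
  \<comment> \<open>Adding the vertices to the zero set puts \<open>v\<close> into
    \<open>dom_energy0 q\<close>; this is possible because \<open>x k\<close> is not a
    vertex.\<close>
  have "\<exists>v\<in>dom_energy q. v (x k) = 1 \<and> (\<forall>y\<in>x ` (UNIV - {k}) \<union> V0 q. v y = 0)"
  proof (rule dom_energy_separates)
    show "x ` (UNIV - {k}) \<union> V0 q \<subseteq> SG q" using xSG vertex_SG by (auto simp: V0_def)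
    show "x k \<notin> x ` (UNIV - {k}) \<union> V0 q" using assms(2,4) by (auto dest: injD)
  qed (auto simp: xSG V0_def)
  then obtain v where v: "v \<in> dom_energy q" "v (x k) = 1" "\<And>i. i \<noteq> k \<Longrightarrow> v (x i) = 0" "\<forall>p\<in>V0 q. v p = 0"
    by auto
  then have v0: "v \<in> dom_energy0 q" by (simp add: dom_energy0_def)
  \<comment> \<open>The combination is paired with \<open>v\<close> at level m, where the form is
    linear. There it gives 0, because the combination vanishes on the gasket, and the limit inherits
    this.\<close>
  have "(\<lambda>m. \<Sum>i\<in>UNIV. c i * graph_form m (\<lambda>y. G y (x i)) v) \<longlonglongrightarrow>
      (\<Sum>i\<in>UNIV. c i * energy_form q (\<lambda>y. G y (x i)) v)"
    by (intro tendsto_intros graph_form_tendsto v(1)) (use green_dom[OF G xSG] in \<open>simp add: dom_energy0_def\<close>)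
  moreover have "(\<Sum>i\<in>UNIV. c i * graph_form m (\<lambda>y. G y (x i)) v) = 0" for m
  proof -
    have "(\<Sum>i\<in>UNIV. c i * graph_form m (\<lambda>y. G y (x i)) v)
        = graph_form m (\<lambda>y. \<Sum>i\<in>UNIV. c i * G y (x i)) v"
      by (simp add: graph_form_sum)
    also have "\<dots> = graph_form m (\<lambda>y. 0) v"
    proof (rule graph_form_cong)
      fix y assume "y \<in> SG q"
      then show "(\<Sum>i\<in>UNIV. c i * G y (x i)) = 0"
        using zero green_symmetric[OF G _ xSG] by simp
    qed simp
    finally show ?thesis by (simp add: graph_form_def)
  qed
  ultimately have "(\<Sum>i\<in>UNIV. c i * energy_form q (\<lambda>y. G y (x i)) v) = 0"
    by (simp add: LIMSEQ_const_iff)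
  also have "(\<Sum>i\<in>UNIV. c i * energy_form q (\<lambda>y. G y (x i)) v) = (\<Sum>i\<in>UNIV. if i = k then c k else 0)"
    using green_reproducing[OF G xSG v0] v by (intro sum.cong) auto
  finally show ?thesis by simp
qed

end

section \<open>The Gram matrix and the interpolation problem\<close>

lemma set_lebesgue_integral_quadratic:
  fixes g :: "'n::finite \<Rightarrow> 'a \<Rightarrow> real"
  assumes "\<And>i j. set_integrable M A (\<lambda>y. g i y * g j y)"
  shows "(LINT y:A|M. (\<Sum>i\<in>UNIV. c i * g i y)\<^sup>2)
    = (\<Sum>i\<in>UNIV. \<Sum>j\<in>UNIV. c i * (c j * (LINT y:A|M. g i y * g j y)))"
proof -
  have int: "integrable M (\<lambda>y. c i * (c j * (indicat_real A y *\<^sub>R (g i y * g j y))))" for i j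
    using assms[of i j] unfolding set_integrable_def by (intro integrable_mult_right)
  have "indicat_real A y *\<^sub>R (\<Sum>i\<in>UNIV. c i * g i y)\<^sup>2
      = (\<Sum>i\<in>UNIV. \<Sum>j\<in>UNIV. c i * (c j * (indicat_real A y *\<^sub>R (g i y * g j y))))" for y
    unfolding power2_eq_square sum_product by (simp add: sum_distrib_left mult_ac)
  then have "(LINT y:A|M. (\<Sum>i\<in>UNIV. c i * g i y)\<^sup>2)
     = (\<integral>y. (\<Sum>i\<in>UNIV. \<Sum>j\<in>UNIV. c i * (c j * (indicat_real A y *\<^sub>R (g i y * g j y)))) \<partial>M)"
    unfolding set_lebesgue_integral_def by simp
  also have "\<dots> = (\<Sum>i\<in>UNIV. \<Sum>j\<in>UNIV. \<integral>y. c i * (c j * (indicat_real A y *\<^sub>R (g i y * g j y))) \<partial>M)"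
    by (simp only: Bochner_Integration.integral_sum Bochner_Integration.integrable_sum int)
  finally show ?thesis unfolding set_lebesgue_integral_def by simp
qed

theorem lemma3p12:
  fixes q :: "3 \<Rightarrow> real^2"
    and \<mu> :: "(real^2) measure"
    and G :: "real^2 \<Rightarrow> real^2 \<Rightarrow> real"
    and x :: "'n::finite \<Rightarrow> real^2"
  assumes "equilateral q"
    and "sg_measure q \<mu>"
    and "dirichlet_green q G"
    and "inj x"
    and "range x \<subseteq> SG q"
    and "range x \<inter> V0 q = {}"
  shows "invertible ((\<chi> i j. LINT y:SG q|\<mu>. G (x i) y * G (x j) y) :: real^'n^'n)
    \<and> (\<forall>a :: 'n \<Rightarrow> real. \<exists>c :: 'n \<Rightarrow> real. \<exists>u :: real^2 \<Rightarrow> real.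
         (\<forall>z\<in>SG q. u z = (\<Sum>i\<in>UNIV. c i * (LINT y:SG q|\<mu>. G z y * G (x i) y)))
         \<and> (\<forall>i. u (x i) = a i)
         \<and> (\<forall>p\<in>V0 q. u p = 0))"
proof -
  obtain s where "s > 0" "\<forall>i j. i \<noteq> j \<longrightarrow> dist (q i) (q j) = s"
    using assms(1) unfolding equilateral_def by blast
  then interpret gasket q s by unfold_locales auto
  define M :: "real^'n^'n" where "M = (\<chi> i j. LINT y:SG q|\<mu>. G (x i) y * G (x j) y)"
  have xSG: "x i \<in> SG q" for i using assms(5) by auto
  have cont: "continuous_on (SG q) (G (x i))" for i by (rule continuous_green[OF assms(3) xSG])
  \<comment> \<open>Trivial kernel suffices for a square matrix. If \<open>M *v c = 0\<close>, the
    quadratic form of \<open>M\<close> at \<open>c\<close> vanishes, and it is the squared norm of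
    the combination with coefficients \<open>c\<close>.\<close>
  have "c = 0" if "M *v c = 0" for c
  proof -
    have "(LINT y:SG q|\<mu>. (\<Sum>i\<in>UNIV. c $ i * G (x i) y)\<^sup>2)
      = (\<Sum>i\<in>UNIV. \<Sum>j\<in>UNIV. c $ i * (c $ j * (LINT y:SG q|\<mu>. G (x i) y * G (x j) y)))"
      by (intro set_lebesgue_integral_quadratic set_integrable_continuous_SG assms(2) continuous_intros cont)
    also have "\<dots> = (\<Sum>i\<in>UNIV. c $ i * (M *v c) $ i)"
      by (simp add: M_def matrix_vector_mult_def sum_distrib_left mult_ac)
    finally have int: "(LINT y:SG q|\<mu>. (\<Sum>i\<in>UNIV. c $ i * G (x i) y)\<^sup>2) = 0" using that by simp
    have "(\<Sum>i\<in>UNIV. c $ i * G (x i) y)\<^sup>2 = 0" if "y \<in> SG q" for y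
      by (rule integral_eq_0_imp_eq_0[OF assms(2) _ _ int that]) (auto intro!: continuous_intros cont)
    then have "c $ k = 0" for k
      by (intro green_independent[OF assms(3-6), where c = "\<lambda>i. c $ i"]) simp
    then show "c = 0" by (simp add: vec_eq_iff)
  qed
  then have inv: "invertible M"
    unfolding invertible_left_inverse matrix_left_invertible_ker by blast
  moreover have "\<exists>c :: 'n \<Rightarrow> real. \<exists>u :: real^2 \<Rightarrow> real.
         (\<forall>z\<in>SG q. u z = (\<Sum>i\<in>UNIV. c i * (LINT y:SG q|\<mu>. G z y * G (x i) y)))
         \<and> (\<forall>i. u (x i) = a i) \<and> (\<forall>p\<in>V0 q. u p = 0)" for a
  proof -
    obtain N where "M ** N = mat 1" using inv unfolding invertible_def by blast
    then have Mc: "M *v (N *v (\<chi> i. a i)) = (\<chi> i. a i)"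
      by (simp add: matrix_vector_mul_assoc)
    \<comment> \<open>These coefficients solve \<open>M c = a\<close>, and \<open>u (x k)\<close> is
      the entry of \<open>M c\<close> at \<open>k\<close>.\<close>
    define c where "c i = (N *v (\<chi> i. a i)) $ i" for i
    define u where "u z = (\<Sum>i\<in>UNIV. c i * (LINT y:SG q|\<mu>. G z y * G (x i) y))" for z
    have "u (x k) = (M *v (N *v (\<chi> i. a i))) $ k" for k
      unfolding u_def c_def by (simp add: M_def matrix_vector_mult_def mult.commute)
    then have "u (x k) = a k" for k unfolding Mc by simp
    moreover have "u p = 0" if "p \<in> V0 q" for p
    proof -
      \<comment> \<open>\<open>G p y = 0\<close> is known only for \<open>y\<close> in
        \<open>SG q\<close>; off the gasket the indicator makes the integrand vanish.\<close>
      have "(LINT y:SG q|\<mu>. G p y * G (x i) y) = 0" for i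
        using green_vertex[OF assms(3) that] unfolding set_lebesgue_integral_def
        by (intro integral_eq_zero_AE AE_I2) (simp add: indicator_def)
      then show ?thesis by (simp add: u_def)
    qed
    ultimately show ?thesis using u_def by blast
  qed
  ultimately show ?thesis unfolding M_def by blast
qed

end
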